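(* Let $\lambda>0$ be fixed. For $k\ne0$ and $c_g,c_f>0$ let $\mu^\ast=\mu^\ast_{k,c_f,c_g}$ be the probability distribution on $\mathbb{R}$ with density proportional to $\exp\left(-\frac{k^2c_g+c_f}{2c_fc_g}x^2\right)$, and for a constant matrix $B=\begin{pmatrix}b_{11}&b_{12}\\ b_{21}&b_{22}\end{pmatrix}\in\mathbb{R}^{2\times2}$ consider the diffusion for $Z_t=(X_t,Y_t)^T\in\mathbb{R}^2$ $$\mathrm{d}Z_t=-\begin{pmatrix}c_g^{-1}&k\\ -\lambda k&\lambda c_f\end{pmatrix}Z_t\,\mathrm{d}t+B\,\mathrm{d}W_t,$$ where $W_t$ is Brownian motion in $\mathbb{R}^2$. Then there exists no choice of the entries of $B$ independent of $c_g,c_f$ and $k$ such that the stationary solution $\pi_\lambda$ of this diffusion has $x$-marginal $\mu^\ast$; that is, there is no $B\in\mathbb{R}^{2\times2}$ such that for all $k\neq0$ and $c_g,c_f>0$ the $x$-marginal of the stationary solution equals $\mu^\ast_{k,c_f,c_g}$.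
   Context: The $x$-marginal of a distribution on $\mathbb{R}^2$ is the law of the first coordinate. The stationary solution $\pi_\lambda$ is the unique stationary distribution of the given linear SDE. *)

theory Defs
  imports "HOL-Probability.Probability"
begin

definition brownian_motion :: "'w measure \<Rightarrow> (real \<Rightarrow> 'w \<Rightarrow> real^'m) \<Rightarrow> bool" where
  "brownian_motion M W \<longleftrightarrow>
     prob_space M \<and>
     (\<forall>t\<ge>0. W t \<in> borel_measurable M) \<and>
     (AE \<omega> in M. W 0 \<omega> = 0) \<and>
     (AE \<omega> in M. continuous_on {0..} (\<lambda>t. W t \<omega>)) \<and>
     (\<forall>s t. 0 \<le> s \<longrightarrow> s < t \<longrightarrow>
        distributed M lborel (\<lambda>\<omega>. W t \<omega> - W s \<omega>)
          (\<lambda>x. ennreal (\<Prod>i\<in>UNIV. normal_density 0 (sqrt (t - s)) (x $ i)))) \<and>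
     (\<forall>(n::nat) (\<tau> :: nat \<Rightarrow> real). 0 \<le> \<tau> 0 \<longrightarrow> mono \<tau> \<longrightarrow>
        prob_space.indep_vars M (\<lambda>_. borel)
          (\<lambda>i \<omega>. W (\<tau> (Suc i)) \<omega> - W (\<tau> i) \<omega>) {..<n})"

text \<open>
  Weak solutions of the linear equation \<open>dZ = A Z dt + B dW\<close>. Since \<open>B\<close> is constant,
  the Ito integral of \<open>B\<close> against \<open>W\<close> over \<open>[0, t]\<close> is \<open>B *v W t\<close>, so the integral form
  of the equation is meaningful path by path. Adaptedness is expressed by
  independence of the initial value from the whole Brownian path.
\<close>

definition linear_sde_solution ::
  "real^'n^'n \<Rightarrow> real^'m^'n \<Rightarrow> 'w measure \<Rightarrow>
     (real \<Rightarrow> 'w \<Rightarrow> real^'m) \<Rightarrow> (real \<Rightarrow> 'w \<Rightarrow> real^'n) \<Rightarrow> bool" where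
  "linear_sde_solution A B M W Z \<longleftrightarrow>
     brownian_motion M W \<and>
     (\<forall>t\<ge>0. Z t \<in> borel_measurable M) \<and>
     prob_space.indep_set M
       (sets (vimage_algebra (space M) (Z 0) borel))
       (sets (vimage_algebra (space M) (\<lambda>\<omega>. \<lambda>t\<in>{0..}. W t \<omega>) (\<Pi>\<^sub>M t\<in>{0..}. borel))) \<and>
     (AE \<omega> in M. continuous_on {0..} (\<lambda>t. Z t \<omega>)) \<and>
     (AE \<omega> in M. \<forall>t\<ge>0.
        Z t \<omega> = Z 0 \<omega> + integral {0..t} (\<lambda>s. A *v Z s \<omega>) + B *v W t \<omega>)"

text \<open>
  The sample space ranges over all measures on the type of joint paths of \<open>(Z, W)\<close>.
  This loses no generality: a solution on any other probability space can be
  transported to this type along the map sending a sample point to its path.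
\<close>

definition stationary_distribution ::
  "real^'n^'n \<Rightarrow> real^'m^'n \<Rightarrow> (real^'n) measure \<Rightarrow> bool" where
  "stationary_distribution A B \<pi> \<longleftrightarrow>
     (\<exists>(M :: (real \<Rightarrow> (real^'n) \<times> (real^'m)) measure) W Z.
        linear_sde_solution A B M W Z \<and> (\<forall>t\<ge>0. distr M borel (Z t) = \<pi>))"

definition x_marginal :: "(real^2) measure \<Rightarrow> real measure" where
  "x_marginal \<pi> = distr \<pi> borel (\<lambda>z. z $ 1)"

definition mu_weight :: "real \<Rightarrow> real \<Rightarrow> real \<Rightarrow> real \<Rightarrow> real" where
  "mu_weight k c\<^sub>f c\<^sub>g x = exp (- ((k\<^sup>2 * c\<^sub>g + c\<^sub>f) / (2 * c\<^sub>f * c\<^sub>g)) * x\<^sup>2)"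

definition mu_star :: "real \<Rightarrow> real \<Rightarrow> real \<Rightarrow> real measure" where
  "mu_star k c\<^sub>f c\<^sub>g =
     density lborel (\<lambda>x. ennreal (mu_weight k c\<^sub>f c\<^sub>g x / (LINT y|lborel. mu_weight k c\<^sub>f c\<^sub>g y)))"

definition coupling_matrix :: "real \<Rightarrow> real \<Rightarrow> real \<Rightarrow> real \<Rightarrow> real^2^2" where
  "coupling_matrix lam k c\<^sub>f c\<^sub>g =
     vector [vector [inverse c\<^sub>g, k],
             vector [- lam * k, lam * c\<^sub>f]]"

end

theory Submission
  imports Defs
begin

text \<open>
  Suppose that one \<open>B\<close> works for all parameters. The second moments of a stationary law satisfy the
  Lyapunov equation, which for each \<open>u\<close> reads
  \<open>2 E[(u \<bullet> z) ((u v* A) \<bullet> z)] + (u v* B) \<bullet> (u v* B) = 0\<close> (\<open>stationary_lyapunov_equation\<close>).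
  For the two-dimensional equation these are three linear equations for the moments
  \<open>E[x\<^sup>2]\<close>, \<open>E[x y]\<close> and \<open>E[y\<^sup>2]\<close>. The required marginal fixes \<open>E[x\<^sup>2]\<close>, so two unknowns remain
  and the system is overdetermined: for each choice of the parameters there is one linear relation
  between the entries of \<open>B B\<^sup>T\<close>. Already the parameters \<open>c\<^sub>f = c\<^sub>g = 1\<close>
  and \<open>k = 1, -1, 2\<close> force the diagonal entries, which are nonnegative, to have a vanishing
  positive combination and yet not both to vanish (\<open>stationary_moment_relations_inconsistent\<close>).

  Two points need care. Only the \<open>x\<close>-marginal is known, so the second moment of \<open>y\<close> could be
  infinite. It is not: as \<open>k \<noteq> 0\<close>, the equation for \<open>x\<close> expresses the time integral of \<open>y\<close>
  by square-integrable variables, and the equation for \<open>y\<close> shows that \<open>y\<close> differs from its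
  time average by a square-integrable amount (\<open>stationary_second_moment_propagates\<close>).
  The Lyapunov equation, in turn, follows from stochastic calculus, but as the noise is additive it
  can be read off the integral equation itself: over a short time \<open>t\<close>, expand
  \<open>(u \<bullet> Z t)\<^sup>2\<close> around \<open>(u \<bullet> Z 0)\<^sup>2\<close>, take expectations, and bound all terms beyond first order in
  \<open>L\<^sup>2\<close>. The only analytic tool for this is a bound for the second moment of a time integral
  (\<open>L2_bounded_time_integral\<close>).
\<close>

section \<open>Second moments of time integrals\<close>

text \<open>
  Riemann sums turn the time integral of a path into a limit of finite sums of random variables.
  Fatou's lemma then controls the moments of the integral. Fubini's theorem would not apply
  directly: a process that is continuous only almost surely may fail to be jointly measurable
  in time and sample point.
\<close>

lemma riemann_sums_tendsto_integral:
  fixes f :: "real \<Rightarrow> real"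
  assumes t: "0 \<le> t" and f: "continuous_on {0..t} f"
  shows "(\<lambda>n. \<Sum>i<n. t / real n * f (t * real i / real n)) \<longlonglongrightarrow> integral {0..t} f"
proof (rule LIMSEQ_I)
  fix r :: real
  assume r: "0 < r"
  \<comment> \<open>\<open>t + 1\<close> and not \<open>t\<close>, which may be zero\<close>
  define e where "e = r / (t + 1)"
  have e: "0 < e" "e * t < r"
    using r t by (auto simp: e_def field_simps)
  have "uniformly_continuous_on {0..t} f"
    using f by (intro compact_uniformly_continuous) auto
  then obtain d where d: "d > 0"
    and fd: "\<And>x y. x \<in> {0..t} \<Longrightarrow> y \<in> {0..t} \<Longrightarrow> dist x y < d \<Longrightarrow> dist (f x) (f y) < e"
    using e(1) unfolding uniformly_continuous_on_def by metis
  obtain n0 :: nat where n0: "t / d < real n0"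
    using reals_Archimedean2 by blast
  have "norm ((\<Sum>i<n. t / real n * f (t * real i / real n)) - integral {0..t} f) < r"
    if n: "n \<ge> Suc n0" for n
  proof -
    define p where "p = (\<lambda>i::nat. t * real i / real n)"
    have n_pos: "real n > 0" using n by simp
    have mesh: "t / real n < d"
    proof -
      have "t / d < real n" using n0 n by linarith
      then show ?thesis using d n_pos by (simp add: field_simps)
    qed
    have p_step: "p (Suc i) - p i = t / real n" for i
      using n_pos by (simp add: p_def field_simps)
    have p_mono: "p i \<le> p (Suc i)" for i
      using p_step[of i] t n_pos by (smt (verit) divide_nonneg_pos)
    have p_nonneg: "0 \<le> p i" for i using t n_pos by (simp add: p_def)
    have p_le: "p i \<le> t" if "i \<le> n" for i
      using that t n_pos by (simp add: p_def divide_le_eq mult_left_mono)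
    have split: "integral {0..p m} f = (\<Sum>i<m. integral {p i..p (Suc i)} f)" if "m \<le> n" for m
      using that
    proof (induction m)
      case 0
      then show ?case by (simp add: p_def)
    next
      case (Suc m)
      have "f integrable_on {0..p (Suc m)}"
        by (intro integrable_continuous_interval continuous_on_subset[OF f])
          (use p_le[OF Suc.prems] in auto)
      then have "integral {0..p m} f + integral {p m..p (Suc m)} f = integral {0..p (Suc m)} f"
        by (intro Henstock_Kurzweil_Integration.integral_combine p_nonneg p_mono)
      then show ?case using Suc by simp
    qed
    have cell: "norm (t / real n * f (p i) - integral {p i..p (Suc i)} f) \<le> e * (t / real n)"
      if "i < n" for i
    proof -
      have sub: "{p i..p (Suc i)} \<subseteq> {0..t}"
        using p_nonneg[of i] p_le[of "Suc i"] that by auto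
      have cont: "continuous_on {p i..p (Suc i)} f" using f sub by (rule continuous_on_subset)
      have "norm (integral {p i..p (Suc i)} (\<lambda>s. f (p i) - f s)) \<le> e * (p (Suc i) - p i)"
      proof (rule integral_bound)
        show "p i \<le> p (Suc i)" by (rule p_mono)
        show "continuous_on {p i..p (Suc i)} (\<lambda>s. f (p i) - f s)"
          by (intro continuous_intros cont)
        fix s assume s: "s \<in> {p i..p (Suc i)}"
        have "dist (f (p i)) (f s) < e"
        proof (rule fd)
          show "p i \<in> {0..t}" using sub p_mono[of i] by auto
          show "s \<in> {0..t}" using sub s by blast
          show "dist (p i) s < d" using s p_step[of i] mesh by (auto simp: dist_real_def)
        qed
        then show "norm (f (p i) - f s) \<le> e" by (simp add: dist_norm)
      qed
      moreover have "integral {p i..p (Suc i)} (\<lambda>s. f (p i) - f s)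
          = t / real n * f (p i) - integral {p i..p (Suc i)} f"
        using p_mono[of i] p_step[of i]
        by (subst Henstock_Kurzweil_Integration.integral_diff) (auto intro!: integrable_continuous_interval cont)
      ultimately show ?thesis using p_step[of i] by simp
    qed
    have "p n = t" using n_pos by (simp add: p_def)
    then have "(\<Sum>i<n. t / real n * f (p i)) - integral {0..t} f
        = (\<Sum>i<n. t / real n * f (p i) - integral {p i..p (Suc i)} f)"
      using split[of n] by (simp add: sum_subtractf)
    also have "norm \<dots> \<le> (\<Sum>i<n. e * (t / real n))"
      by (intro sum_norm_le cell) simp
    also have "\<dots> = e * t" using n_pos by simp
    finally show ?thesis using e(2) by (simp add: p_def)
  qed
  then show "\<exists>no. \<forall>n\<ge>no. norm ((\<Sum>i<n. t / real n * f (t * real i / real n)) - integral {0..t} f) < r"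
    by blast
qed

text \<open>
  Carrying the bound \<open>K\<close> along makes uniformity in time a matter of choosing one
  \<open>K\<close> for all the random variables of a process.
\<close>

definition L2_bounded :: "'w measure \<Rightarrow> real \<Rightarrow> ('w \<Rightarrow> real) \<Rightarrow> bool" where
  "L2_bounded M K f \<longleftrightarrow>
     f \<in> borel_measurable M \<and> integrable M (\<lambda>\<omega>. (f \<omega>)\<^sup>2) \<and> (\<integral>\<omega>. (f \<omega>)\<^sup>2 \<partial>M) \<le> K"

lemma L2_bounded_measurable: "L2_bounded M K f \<Longrightarrow> f \<in> borel_measurable M"
  by (simp add: L2_bounded_def)

lemma L2_bounded_square_integrable: "L2_bounded M K f \<Longrightarrow> integrable M (\<lambda>\<omega>. (f \<omega>)\<^sup>2)"
  by (simp add: L2_bounded_def)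

lemma L2_bounded_le: "L2_bounded M K f \<Longrightarrow> (\<integral>\<omega>. (f \<omega>)\<^sup>2 \<partial>M) \<le> K"
  by (simp add: L2_bounded_def)

lemma L2_bounded_nonneg: "L2_bounded M K f \<Longrightarrow> 0 \<le> K"
  unfolding L2_bounded_def by (meson integral_nonneg zero_le_power2 order_trans Bochner_Integration.integral_nonneg)

lemma L2_bounded_mono: "L2_bounded M K f \<Longrightarrow> K \<le> L \<Longrightarrow> L2_bounded M L f"
  by (auto simp: L2_bounded_def)

lemma L2_bounded_iff_nn_integral:
  assumes "f \<in> borel_measurable M" "0 \<le> K"
  shows "L2_bounded M K f \<longleftrightarrow> (\<integral>\<^sup>+\<omega>. ennreal ((f \<omega>)\<^sup>2) \<partial>M) \<le> ennreal K"
proof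
  assume "L2_bounded M K f"
  then show "(\<integral>\<^sup>+\<omega>. ennreal ((f \<omega>)\<^sup>2) \<partial>M) \<le> ennreal K"
    by (subst nn_integral_eq_integral) (auto simp: L2_bounded_def intro: ennreal_leI)
next
  assume le: "(\<integral>\<^sup>+\<omega>. ennreal ((f \<omega>)\<^sup>2) \<partial>M) \<le> ennreal K"
  have int: "integrable M (\<lambda>\<omega>. (f \<omega>)\<^sup>2)"
  proof (rule integrableI_nonneg)
    show "(\<integral>\<^sup>+\<omega>. ennreal ((f \<omega>)\<^sup>2) \<partial>M) < \<infinity>"
      using le by (rule order_le_less_trans) simp
  qed (use assms in auto)
  then have "ennreal (\<integral>\<omega>. (f \<omega>)\<^sup>2 \<partial>M) \<le> ennreal K"
    using le by (subst (asm) nn_integral_eq_integral) auto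
  then show "L2_bounded M K f"
    using assms int by (simp add: L2_bounded_def ennreal_le_iff)
qed

lemma L2_bounded_cong_AE:
  assumes "L2_bounded M K f" "g \<in> borel_measurable M" "AE \<omega> in M. f \<omega> = g \<omega>"
  shows "L2_bounded M K g"
proof -
  have ae: "AE \<omega> in M. (f \<omega>)\<^sup>2 = (g \<omega>)\<^sup>2" using assms(3) by eventually_elim simp
  have m: "(\<lambda>\<omega>. (f \<omega>)\<^sup>2) \<in> borel_measurable M" "(\<lambda>\<omega>. (g \<omega>)\<^sup>2) \<in> borel_measurable M"
    using L2_bounded_measurable[OF assms(1)] assms(2) by auto
  show ?thesis
    using assms(1,2) integrable_cong_AE[OF m ae] integral_cong_AE[OF m ae]
    by (simp add: L2_bounded_def)
qed

lemma L2_bounded_cmult: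
  assumes "L2_bounded M K f"
  shows "L2_bounded M (c\<^sup>2 * K) (\<lambda>\<omega>. c * f \<omega>)"
  using assms by (auto simp: L2_bounded_def power_mult_distrib intro: mult_left_mono)

lemma L2_bounded_add:
  assumes f: "L2_bounded M K f" and g: "L2_bounded M L g"
  shows "L2_bounded M (2 * K + 2 * L) (\<lambda>\<omega>. f \<omega> + g \<omega>)"
proof -
  note [measurable] = L2_bounded_measurable[OF f] L2_bounded_measurable[OF g]
  note int = L2_bounded_square_integrable[OF f] L2_bounded_square_integrable[OF g]
  have le: "(f \<omega> + g \<omega>)\<^sup>2 \<le> 2 * (f \<omega>)\<^sup>2 + 2 * (g \<omega>)\<^sup>2" for \<omega>
    using zero_le_power2[of "f \<omega> - g \<omega>"] by (simp add: power2_eq_square algebra_simps)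
  have int': "integrable M (\<lambda>\<omega>. 2 * (f \<omega>)\<^sup>2 + 2 * (g \<omega>)\<^sup>2)" using int by auto
  have int'': "integrable M (\<lambda>\<omega>. (f \<omega> + g \<omega>)\<^sup>2)"
    by (rule Bochner_Integration.integrable_bound[OF int']) (use le in auto)
  have "(\<integral>\<omega>. (f \<omega> + g \<omega>)\<^sup>2 \<partial>M) \<le> (\<integral>\<omega>. 2 * (f \<omega>)\<^sup>2 + 2 * (g \<omega>)\<^sup>2 \<partial>M)"
    using int'' int' le by (rule integral_mono)
  also have "\<dots> = 2 * (\<integral>\<omega>. (f \<omega>)\<^sup>2 \<partial>M) + 2 * (\<integral>\<omega>. (g \<omega>)\<^sup>2 \<partial>M)"
    using int by simp
  also have "\<dots> \<le> 2 * K + 2 * L" using L2_bounded_le[OF f] L2_bounded_le[OF g] by simp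
  finally show ?thesis using int'' by (auto simp: L2_bounded_def)
qed

lemma L2_bounded_diff:
  assumes f: "L2_bounded M K f" and g: "L2_bounded M L g"
  shows "L2_bounded M (2 * K + 2 * L) (\<lambda>\<omega>. f \<omega> - g \<omega>)"
  using L2_bounded_add[OF f L2_bounded_cmult[OF g, of "-1"]] by simp

text \<open>
  Young's inequality stands in for the Cauchy--Schwarz inequality: the free weight \<open>e\<close> is
  chosen later so as to balance two factors that vanish at different rates.
\<close>

lemma L2_bounded_product:
  assumes f: "L2_bounded M K f" and g: "L2_bounded M L g" and e: "0 < e"
  shows "integrable M (\<lambda>\<omega>. f \<omega> * g \<omega>)"
    and "\<bar>\<integral>\<omega>. f \<omega> * g \<omega> \<partial>M\<bar> \<le> (e * K + L / e) / 2"
proof -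
  note [measurable] = L2_bounded_measurable[OF f] L2_bounded_measurable[OF g]
  note int = L2_bounded_square_integrable[OF f] L2_bounded_square_integrable[OF g]
  have le: "\<bar>f \<omega> * g \<omega>\<bar> \<le> (e * (f \<omega>)\<^sup>2 + (g \<omega>)\<^sup>2 / e) / 2" for \<omega>
  proof -
    have "0 \<le> (e * \<bar>f \<omega>\<bar> - \<bar>g \<omega>\<bar>)\<^sup>2 / e" using e by simp
    also have "\<dots> = e * (f \<omega>)\<^sup>2 + (g \<omega>)\<^sup>2 / e - 2 * \<bar>f \<omega> * g \<omega>\<bar>"
      using e by (simp add: power2_diff power_mult_distrib abs_mult field_simps power2_eq_square)
    finally show ?thesis by simp
  qed
  have int': "integrable M (\<lambda>\<omega>. (e * (f \<omega>)\<^sup>2 + (g \<omega>)\<^sup>2 / e) / 2)" using int by auto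
  show i: "integrable M (\<lambda>\<omega>. f \<omega> * g \<omega>)"
    by (rule Bochner_Integration.integrable_bound[OF int'])
      (use le in \<open>auto intro: order_trans[OF _ abs_ge_self]\<close>)
  have "\<bar>\<integral>\<omega>. f \<omega> * g \<omega> \<partial>M\<bar> \<le> (\<integral>\<omega>. \<bar>f \<omega> * g \<omega>\<bar> \<partial>M)" by simp
  also have "\<dots> \<le> (\<integral>\<omega>. (e * (f \<omega>)\<^sup>2 + (g \<omega>)\<^sup>2 / e) / 2 \<partial>M)"
    using i int' le by (intro integral_mono) auto
  also have "\<dots> = (e * (\<integral>\<omega>. (f \<omega>)\<^sup>2 \<partial>M) + (\<integral>\<omega>. (g \<omega>)\<^sup>2 \<partial>M) / e) / 2"
    using int by simp
  also have "\<dots> \<le> (e * K + L / e) / 2"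
    using L2_bounded_le[OF f] L2_bounded_le[OF g] e
    by (intro divide_right_mono add_mono mult_left_mono) auto
  finally show "\<bar>\<integral>\<omega>. f \<omega> * g \<omega> \<partial>M\<bar> \<le> (e * K + L / e) / 2" .
qed

text \<open>
  A weak form of Minkowski's integral inequality. Each Riemann sum obeys the bound by convexity of
  the square, and Fatou's lemma passes it on to the limit.
\<close>

lemma L2_bounded_time_integral:
  fixes g :: "real \<Rightarrow> 'w \<Rightarrow> real"
  assumes t: "0 \<le> t"
    and g: "\<And>s. 0 \<le> s \<Longrightarrow> s \<le> t \<Longrightarrow> L2_bounded M K (g s)"
    and cont: "AE \<omega> in M. continuous_on {0..t} (\<lambda>s. g s \<omega>)"
    and F: "F \<in> borel_measurable M" "AE \<omega> in M. F \<omega> = integral {0..t} (\<lambda>s. g s \<omega>)"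
  shows "L2_bounded M (t\<^sup>2 * K) F"
proof -
  define S where "S = (\<lambda>n \<omega>. \<Sum>i<n. t / real n * g (t * real i / real n) \<omega>)"
  have K: "0 \<le> K" using L2_bounded_nonneg[OF g[of 0]] t by simp
  have node: "0 \<le> t * real i / real n" "t * real i / real n \<le> t" if "i < n" for i n
    using that t by (auto simp: divide_le_eq mult_left_mono)
  have Sm: "S n \<in> borel_measurable M" for n
    unfolding S_def using L2_bounded_measurable[OF g[OF node]] by (intro borel_measurable_sum) auto
  have S_le: "(\<integral>\<^sup>+\<omega>. ennreal ((S n \<omega>)\<^sup>2) \<partial>M) \<le> ennreal (t\<^sup>2 * K)" for n
  proof (cases "n = 0")
    case True
    then show ?thesis by (simp add: S_def)
  next
    case False
    have le: "(S n \<omega>)\<^sup>2 \<le> (\<Sum>i<n. t\<^sup>2 / real n * (g (t * real i / real n) \<omega>)\<^sup>2)" for \<omega>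
    proof -
      \<comment> \<open>convexity of the square, in the form of the Cauchy--Schwarz inequality for sums\<close>
      have "(\<Sum>i<n. g (t * real i / real n) \<omega>)\<^sup>2 \<le> real n * (\<Sum>i<n. (g (t * real i / real n) \<omega>)\<^sup>2)"
        using sum_squared_le_sum_of_squares[of "\<lambda>i. g (t * real i / real n) \<omega>" "{..<n}"] False
        by (simp add: mult.commute)
      then have "(t / real n)\<^sup>2 * (\<Sum>i<n. g (t * real i / real n) \<omega>)\<^sup>2
          \<le> (t / real n)\<^sup>2 * (real n * (\<Sum>i<n. (g (t * real i / real n) \<omega>)\<^sup>2))"
        by (intro mult_left_mono) auto
      moreover have "(S n \<omega>)\<^sup>2 = (t / real n)\<^sup>2 * (\<Sum>i<n. g (t * real i / real n) \<omega>)\<^sup>2"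
        by (simp only: S_def sum_distrib_left[symmetric] power_mult_distrib)
      moreover have "(t / real n)\<^sup>2 * (real n * X) = t\<^sup>2 / real n * X" for X
        using False by (simp add: power2_eq_square)
      ultimately show ?thesis by (simp only: sum_distrib_left[symmetric])
    qed
    have int: "integrable M (\<lambda>\<omega>. (g (t * real i / real n) \<omega>)\<^sup>2)" if "i < n" for i
      using L2_bounded_square_integrable[OF g[OF node[OF that]]] .
    have "(\<integral>\<^sup>+\<omega>. ennreal ((S n \<omega>)\<^sup>2) \<partial>M)
        \<le> (\<integral>\<^sup>+\<omega>. ennreal (\<Sum>i<n. t\<^sup>2 / real n * (g (t * real i / real n) \<omega>)\<^sup>2) \<partial>M)"
      by (intro nn_integral_mono ennreal_leI le)
    also have "\<dots> = ennreal (\<integral>\<omega>. (\<Sum>i<n. t\<^sup>2 / real n * (g (t * real i / real n) \<omega>)\<^sup>2) \<partial>M)"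
      using int by (intro nn_integral_eq_integral) (auto intro!: sum_nonneg)
    also have "(\<integral>\<omega>. (\<Sum>i<n. t\<^sup>2 / real n * (g (t * real i / real n) \<omega>)\<^sup>2) \<partial>M)
        = (\<Sum>i<n. t\<^sup>2 / real n * (\<integral>\<omega>. (g (t * real i / real n) \<omega>)\<^sup>2 \<partial>M))"
      using int by (subst Bochner_Integration.integral_sum) auto
    also have "\<dots> \<le> (\<Sum>i<n. t\<^sup>2 / real n * K)"
      using L2_bounded_le[OF g[OF node]] by (intro sum_mono mult_left_mono) auto
    also have "\<dots> = t\<^sup>2 * K" using False by simp
    finally show ?thesis by (simp add: ennreal_leI)
  qed
  have "(\<integral>\<^sup>+\<omega>. ennreal ((F \<omega>)\<^sup>2) \<partial>M) \<le> (\<integral>\<^sup>+\<omega>. liminf (\<lambda>n. ennreal ((S n \<omega>)\<^sup>2)) \<partial>M)"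
  proof (rule nn_integral_mono_AE)
    show "AE \<omega> in M. ennreal ((F \<omega>)\<^sup>2) \<le> liminf (\<lambda>n. ennreal ((S n \<omega>)\<^sup>2))"
      using cont F(2)
    proof eventually_elim
      fix \<omega>
      assume "continuous_on {0..t} (\<lambda>s. g s \<omega>)" and "F \<omega> = integral {0..t} (\<lambda>s. g s \<omega>)"
      then have "(\<lambda>n. S n \<omega>) \<longlonglongrightarrow> F \<omega>"
        using riemann_sums_tendsto_integral[OF t, of "\<lambda>s. g s \<omega>"] by (simp add: S_def)
      then have "(\<lambda>n. ennreal ((S n \<omega>)\<^sup>2)) \<longlonglongrightarrow> ennreal ((F \<omega>)\<^sup>2)"
        by (intro tendsto_ennrealI tendsto_power)
      then show "ennreal ((F \<omega>)\<^sup>2) \<le> liminf (\<lambda>n. ennreal ((S n \<omega>)\<^sup>2))"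
        using lim_imp_Liminf[OF sequentially_bot] by (metis order_refl)
    qed
  qed
  also have "\<dots> \<le> liminf (\<lambda>n. \<integral>\<^sup>+\<omega>. ennreal ((S n \<omega>)\<^sup>2) \<partial>M)"
    using Sm by (intro nn_integral_liminf) auto
  also have "\<dots> \<le> liminf (\<lambda>n. ennreal (t\<^sup>2 * K))"
    by (intro Liminf_mono always_eventually allI S_le)
  also have "\<dots> = ennreal (t\<^sup>2 * K)" by (simp add: Liminf_const)
  finally show ?thesis
    using F(1) K by (subst L2_bounded_iff_nn_integral) auto
qed

section \<open>Moments of Brownian motion\<close>

text \<open>
  Fubini's theorem for product functions, with coordinates indexed by \<open>'m\<close> instead of by
  the basis vectors that Lebesgue measure on a Euclidean space is built from.
\<close>

lemma lborel_vec_integral_prod: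
  fixes g :: "'m::finite \<Rightarrow> real \<Rightarrow> real"
  assumes g: "\<And>i. integrable lborel (g i)"
  shows "integrable lborel (\<lambda>x::real^'m. \<Prod>i\<in>UNIV. g i (x $ i))" (is ?int)
    and "(\<integral>x. (\<Prod>i\<in>UNIV. g i ((x::real^'m) $ i)) \<partial>lborel) = (\<Prod>i\<in>UNIV. \<integral>y. g i y \<partial>lborel)" (is ?eq)
proof -
  define e :: "'m \<Rightarrow> real^'m" where "e = (\<lambda>i. axis i 1)"
  define G where "G = (\<lambda>b. g (inv e b))"
  have inj: "inj e" by (auto simp: e_def inj_def axis_eq_axis)
  have Basis: "(Basis :: (real^'m) set) = range e" by (auto simp: e_def Basis_vec_def)
  have reindex: "(\<Prod>b\<in>Basis. h b) = (\<Prod>i\<in>UNIV. h (e i))" for h :: "real^'m \<Rightarrow> real"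
    unfolding Basis using inj by (simp add: prod.reindex)
  have G_e: "G (e i) = g i" for i using inj by (simp add: G_def)
  have G: "integrable lborel (G b)" for b using g by (simp add: G_def)
  have [measurable]: "G b \<in> borel_measurable borel" for b
    using borel_measurable_integrable[OF G] by simp
  have coord: "(\<Prod>i\<in>UNIV. g i (x $ i)) = (\<Prod>b\<in>Basis. G b (x \<bullet> b))" for x
    by (simp add: reindex G_e) (simp add: e_def inner_axis)
  interpret product_sigma_finite "\<lambda>_::real^'m. lborel :: real measure" ..
  have on_coords: "(\<Prod>b\<in>Basis. G b ((\<Sum>b\<in>Basis. f b *\<^sub>R b) \<bullet> b)) = (\<Prod>b\<in>Basis. G b (f b))"
    for f :: "real^'m \<Rightarrow> real"
    by (intro prod.cong refl) (simp add: inner_sum_left inner_Basis if_distrib cong: if_cong)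
  have meas: "(\<lambda>x::real^'m. \<Prod>b\<in>Basis. G b (x \<bullet> b)) \<in> borel_measurable borel" by measurable
  have map: "(\<lambda>f. \<Sum>b\<in>Basis. f b *\<^sub>R b) \<in> measurable (\<Pi>\<^sub>M b\<in>(Basis :: (real^'m) set). (lborel :: real measure)) borel"
    by measurable
  show ?int
    unfolding coord lborel_eq[where 'a="real^'m"]
    by (subst integrable_distr_eq[OF map meas]) (simp only: on_coords, intro product_integrable_prod G finite_Basis)
  have "(\<integral>x. (\<Prod>b\<in>Basis. G b ((x::real^'m) \<bullet> b)) \<partial>lborel) = (\<Prod>b\<in>Basis. \<integral>y. G b y \<partial>lborel)"
    unfolding lborel_eq[where 'a="real^'m"]
    by (subst integral_distr[OF map meas]) (simp only: on_coords, intro product_integral_prod G finite_Basis)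
  then show ?eq by (simp add: coord reindex G_e)
qed

lemma brownian_motion_prob_space: "brownian_motion M W \<Longrightarrow> prob_space M"
  by (simp add: brownian_motion_def)

lemma brownian_motion_measurable: "brownian_motion M W \<Longrightarrow> 0 \<le> t \<Longrightarrow> W t \<in> borel_measurable M"
  by (simp add: brownian_motion_def)

lemma normal_product_moments:
  fixes i j :: "'m::finite"
  assumes s: "0 < \<sigma>"
  defines "d \<equiv> (\<lambda>x::real^'m. \<Prod>l\<in>UNIV. normal_density 0 \<sigma> (x $ l))"
  shows "has_bochner_integral lborel (\<lambda>x. d x * x $ i) 0"
    and "has_bochner_integral lborel (\<lambda>x. d x * (x $ i * x $ j)) (if i = j then \<sigma>\<^sup>2 else 0)"
proof -
  have m0: "has_bochner_integral lborel (normal_density 0 \<sigma>) 1"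
    and m1: "has_bochner_integral lborel (\<lambda>y. normal_density 0 \<sigma> y * y) 0"
    and m2: "has_bochner_integral lborel (\<lambda>y. normal_density 0 \<sigma> y * (y * y)) (\<sigma>\<^sup>2)"
    using normal_moment_even[OF s, of 0 0] normal_moment_odd[OF s, of 0 0] normal_moment_even[OF s, of 0 1]
    by (simp_all add: power2_eq_square fact_numeral)
  define g1 where "g1 = (\<lambda>l y. normal_density 0 \<sigma> y * (if l = i then y else 1))"
  have g1: "has_bochner_integral lborel (g1 l) (if l = i then 0 else 1)" for l
    using m0 m1 by (simp add: g1_def)
  have "has_bochner_integral lborel (\<lambda>x. \<Prod>l\<in>UNIV. g1 l (x $ l)) (\<Prod>l\<in>UNIV. if l = i then 0 else 1)"
    using lborel_vec_integral_prod[of g1] g1 by (simp add: has_bochner_integral_iff)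
  moreover have "(\<lambda>x. \<Prod>l\<in>UNIV. g1 l (x $ l)) = (\<lambda>x. d x * x $ i)"
    by (rule ext) (simp add: g1_def d_def prod.distrib)
  ultimately show "has_bochner_integral lborel (\<lambda>x. d x * x $ i) 0" by simp
  define g2 where "g2 = (\<lambda>l y. normal_density 0 \<sigma> y * ((if l = i then y else 1) * (if l = j then y else 1)))"
  define v2 where "v2 = (\<lambda>l. if l = i then if l = j then \<sigma>\<^sup>2 else 0 else if l = j then 0 else 1)"
  have g2: "has_bochner_integral lborel (g2 l) (v2 l)" for l
    using m0 m1 m2 by (simp add: g2_def v2_def)
  have "has_bochner_integral lborel (\<lambda>x. \<Prod>l\<in>UNIV. g2 l (x $ l)) (\<Prod>l\<in>UNIV. v2 l)"
    using lborel_vec_integral_prod[of g2] g2 by (simp add: has_bochner_integral_iff)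
  moreover have "(\<lambda>x. \<Prod>l\<in>UNIV. g2 l (x $ l)) = (\<lambda>x. d x * (x $ i * x $ j))"
    by (rule ext) (simp add: g2_def d_def prod.distrib)
  moreover have "(\<Prod>l\<in>UNIV. v2 l) = (if i = j then \<sigma>\<^sup>2 else 0)"
  proof (cases "i = j")
    case True
    then have "v2 = (\<lambda>l. if l = i then \<sigma>\<^sup>2 else 1)" by (auto simp: v2_def fun_eq_iff)
    then show ?thesis using True by simp
  next
    case False
    then have "v2 i = 0" by (simp add: v2_def)
    then have "(\<Prod>l\<in>UNIV. v2 l) = 0" by (intro prod_zero) auto
    then show ?thesis using False by simp
  qed
  ultimately show "has_bochner_integral lborel (\<lambda>x. d x * (x $ i * x $ j)) (if i = j then \<sigma>\<^sup>2 else 0)"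
    by simp
qed

text \<open>
  The moments of the increment \<open>W t - W 0\<close> are those of its density, and
  \<open>W 0\<close> vanishes almost surely.
\<close>

lemma brownian_motion_moments:
  fixes W :: "real \<Rightarrow> 'w \<Rightarrow> real^'m"
  assumes bm: "brownian_motion M W" and t: "0 < t"
  shows "has_bochner_integral M (\<lambda>\<omega>. b \<bullet> W t \<omega>) 0"
    and "has_bochner_integral M (\<lambda>\<omega>. (b \<bullet> W t \<omega>)\<^sup>2) (t * (b \<bullet> b))"
proof -
  define d where "d = (\<lambda>x::real^'m. \<Prod>i\<in>UNIV. normal_density 0 (sqrt t) (x $ i))"
  define D where "D = (\<lambda>\<omega>. W t \<omega> - W 0 \<omega>)"
  have d_nonneg: "0 \<le> d x" for x by (auto simp: d_def intro: prod_nonneg)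
  have [measurable]: "W t \<in> borel_measurable M" "W 0 \<in> borel_measurable M"
    using bm t by (simp_all add: brownian_motion_def)
  have D: "distributed M lborel D (\<lambda>x. ennreal (d x))"
  proof -
    have "\<forall>s t. 0 \<le> s \<longrightarrow> s < t \<longrightarrow> distributed M lborel (\<lambda>\<omega>. W t \<omega> - W s \<omega>)
        (\<lambda>x. ennreal (\<Prod>i\<in>UNIV. normal_density 0 (sqrt (t - s)) (x $ i)))"
      using bm by (simp add: brownian_motion_def)
    from this[THEN spec, THEN spec, of 0 t] show ?thesis
      using t by (simp add: D_def[abs_def] d_def)
  qed
  have law: "has_bochner_integral M (\<lambda>\<omega>. h (W t \<omega>)) v"
    if [measurable]: "h \<in> borel_measurable borel" and v: "has_bochner_integral lborel (\<lambda>x. d x * h x) v"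
    for h :: "real^'m \<Rightarrow> real" and v
  proof -
    have hD: "has_bochner_integral M (\<lambda>\<omega>. h (D \<omega>)) v"
      using v distributed_integrable[OF D, of h] distributed_integral[OF D, of h] d_nonneg that(1)
      by (simp add: has_bochner_integral_iff)
    have "AE \<omega> in M. W 0 \<omega> = 0" using bm by (simp add: brownian_motion_def)
    then have ae: "AE \<omega> in M. h (D \<omega>) = h (W t \<omega>)" by eventually_elim (simp add: D_def)
    have "(\<lambda>\<omega>. h (D \<omega>)) \<in> borel_measurable M" "(\<lambda>\<omega>. h (W t \<omega>)) \<in> borel_measurable M"
      by (simp_all add: D_def)
    then show ?thesis using hD ae by (subst has_bochner_integral_cong_AE[where g="\<lambda>\<omega>. h (D \<omega>)"]) auto
  qed
  have "has_bochner_integral lborel (\<lambda>x. \<Sum>i\<in>UNIV. b $ i * (d x * x $ i)) (\<Sum>i\<in>UNIV. b $ i * 0)"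
    unfolding d_def using t by (intro has_bochner_integral_sum has_bochner_integral_mult_right normal_product_moments) auto
  then show "has_bochner_integral M (\<lambda>\<omega>. b \<bullet> W t \<omega>) 0"
    by (intro law) (auto simp: inner_vec_def sum_distrib_left algebra_simps)
  have "has_bochner_integral lborel (\<lambda>x. \<Sum>i\<in>UNIV. \<Sum>j\<in>UNIV. b $ i * b $ j * (d x * (x $ i * x $ j)))
      (\<Sum>i\<in>UNIV. \<Sum>j\<in>UNIV. b $ i * b $ j * (if i = j then (sqrt t)\<^sup>2 else 0))"
    unfolding d_def using t by (intro has_bochner_integral_sum has_bochner_integral_mult_right normal_product_moments) auto
  moreover have "(\<Sum>i\<in>UNIV. \<Sum>j\<in>UNIV. b $ i * b $ j * (if i = j then (sqrt t)\<^sup>2 else 0)) = t * (b \<bullet> b)"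
    using t by (simp add: inner_vec_def sum_distrib_left if_distrib algebra_simps cong: if_cong)
  moreover have "(\<lambda>x. \<Sum>i\<in>UNIV. \<Sum>j\<in>UNIV. b $ i * b $ j * (d x * (x $ i * x $ j))) = (\<lambda>x. d x * (b \<bullet> x)\<^sup>2)"
    by (simp add: inner_vec_def power2_eq_square sum_product sum_distrib_left algebra_simps)
  ultimately show "has_bochner_integral M (\<lambda>\<omega>. (b \<bullet> W t \<omega>)\<^sup>2) (t * (b \<bullet> b))"
    by (intro law) auto
qed

text \<open>
  Independence is given between the initial value and the whole Brownian path; a functional of
  \<open>W t\<close> is measurable with respect to the path, by evaluation at \<open>t\<close>.
\<close>

lemma linear_sde_initial_noise_indep:
  fixes W :: "real \<Rightarrow> 'w \<Rightarrow> real^'m" and Z :: "real \<Rightarrow> 'w \<Rightarrow> real^'n"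
  assumes sol: "linear_sde_solution A B M W Z" and t: "0 \<le> t"
  shows "prob_space.indep_var M borel (\<lambda>\<omega>. u \<bullet> Z 0 \<omega>) borel (\<lambda>\<omega>. b \<bullet> W t \<omega>)"
proof -
  have bm: "brownian_motion M W" using sol by (simp add: linear_sde_solution_def)
  then interpret prob_space M by (rule brownian_motion_prob_space)
  define P where "P = (\<lambda>\<omega>. \<lambda>t\<in>{0..}. W t \<omega>)"
  let ?PM = "\<Pi>\<^sub>M t\<in>{0::real..}. (borel :: (real^'m) measure)"
  let ?VZ = "vimage_algebra (space M) (Z 0) borel" and ?VW = "vimage_algebra (space M) P ?PM"
  have [measurable]: "W t \<in> borel_measurable M" "Z 0 \<in> borel_measurable M"
    using sol bm t by (auto simp: linear_sde_solution_def brownian_motion_def)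
  have P_space: "P \<in> space M \<rightarrow> space ?PM" by (auto simp: P_def space_PiM)
  have ind: "indep_set (sets ?VZ) (sets ?VW)"
    using sol by (simp add: linear_sde_solution_def P_def)
  have Z_meas: "(\<lambda>\<omega>. u \<bullet> Z 0 \<omega>) \<in> borel_measurable ?VZ"
    by (intro borel_measurable_inner borel_measurable_const measurable_vimage_algebra1) simp
  have "(\<lambda>\<omega>. P \<omega> t) \<in> borel_measurable ?VW"
    using t by (intro measurable_compose[OF measurable_vimage_algebra1[OF P_space] measurable_component_singleton]) simp
  then have "W t \<in> borel_measurable ?VW" using t by (simp add: P_def)
  then have W_meas: "(\<lambda>\<omega>. b \<bullet> W t \<omega>) \<in> borel_measurable ?VW"
    by (intro borel_measurable_inner borel_measurable_const)
  have sub: "sigma_sets (space M) {f -` A \<inter> space M |A. A \<in> sets borel} \<subseteq> sets V"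
    if f: "f \<in> borel_measurable V" and V: "space V = space M" for f :: "'w \<Rightarrow> real" and V
    using measurable_sets[OF f] by (intro sets.sigma_sets_subset[of _ V, unfolded V]) (auto simp: V)
  have "indep_set (sigma_sets (space M) {(\<lambda>\<omega>. u \<bullet> Z 0 \<omega>) -` A \<inter> space M |A. A \<in> sets borel})
      (sigma_sets (space M) {(\<lambda>\<omega>. b \<bullet> W t \<omega>) -` A \<inter> space M |A. A \<in> sets borel})"
    using ind sub[OF Z_meas] sub[OF W_meas] unfolding indep_set_def
    by (elim indep_sets_mono_sets) (auto split: bool.split)
  then show ?thesis by (simp add: indep_var_eq)
qed

lemma linear_sde_initial_noise_uncorrelated:
  fixes W :: "real \<Rightarrow> 'w \<Rightarrow> real^'m" and Z :: "real \<Rightarrow> 'w \<Rightarrow> real^'n"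
  assumes sol: "linear_sde_solution A B M W Z" and t: "0 < t"
    and u: "integrable M (\<lambda>\<omega>. u \<bullet> Z 0 \<omega>)"
  shows "(\<integral>\<omega>. (u \<bullet> Z 0 \<omega>) * (b \<bullet> W t \<omega>) \<partial>M) = 0"
proof -
  have bm: "brownian_motion M W" using sol by (simp add: linear_sde_solution_def)
  then interpret prob_space M by (rule brownian_motion_prob_space)
  have m: "has_bochner_integral M (\<lambda>\<omega>. b \<bullet> W t \<omega>) 0"
    using bm t by (rule brownian_motion_moments)
  show ?thesis
    using indep_var_lebesgue_integral[OF linear_sde_initial_noise_indep[OF sol less_imp_le[OF t]] u] m
    by (simp add: has_bochner_integral_iff)
qed

section \<open>Second moments of stationary solutions\<close>

lemma linear_sde_scalar_continuous:
  assumes "linear_sde_solution A B M W Z"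
  shows "AE \<omega> in M. continuous_on {0..t} (\<lambda>s. v \<bullet> Z s \<omega>)"
proof -
  have "AE \<omega> in M. continuous_on {0..} (\<lambda>s. Z s \<omega>)"
    using assms by (simp add: linear_sde_solution_def)
  then show ?thesis
    by eventually_elim (intro continuous_intros, erule continuous_on_subset, auto)
qed

text \<open>
  The equation is tested against a fixed vector \<open>u\<close>, so that only scalar processes occur
  below; the drift and the noise become the functionals \<open>u v* A\<close> and \<open>u v* B\<close>.
\<close>

lemma linear_sde_scalar_equation:
  fixes A :: "real^'n^'n" and B :: "real^'m^'n"
  assumes sol: "linear_sde_solution A B M W Z" and t: "0 \<le> t"
  shows "AE \<omega> in M. u \<bullet> Z t \<omega> - u \<bullet> Z 0 \<omega> - (u v* B) \<bullet> W t \<omega> = integral {0..t} (\<lambda>s. (u v* A) \<bullet> Z s \<omega>)"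
proof -
  have "AE \<omega> in M. continuous_on {0..} (\<lambda>s. Z s \<omega>)"
    and "AE \<omega> in M. \<forall>t\<ge>0. Z t \<omega> = Z 0 \<omega> + integral {0..t} (\<lambda>s. A *v Z s \<omega>) + B *v W t \<omega>"
    using sol by (simp_all add: linear_sde_solution_def)
  then show ?thesis
  proof eventually_elim
    case (elim \<omega>)
    have "continuous_on {0..t} (\<lambda>s. A *v Z s \<omega>)"
      by (intro continuous_on_subset[OF elim(1)] bounded_linear.continuous_on[OF matrix_vector_mul_bounded_linear]) auto
    then have "(\<lambda>s. A *v Z s \<omega>) integrable_on {0..t}" by (rule integrable_continuous_interval)
    then have "integral {0..t} (\<lambda>s. u \<bullet> (A *v Z s \<omega>)) = u \<bullet> integral {0..t} (\<lambda>s. A *v Z s \<omega>)"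
      using integral_linear[OF _ bounded_linear_inner_right[of u]] by (simp add: comp_def)
    moreover have "Z t \<omega> = Z 0 \<omega> + integral {0..t} (\<lambda>s. A *v Z s \<omega>) + B *v W t \<omega>"
      using elim(2) t by blast
    then have "u \<bullet> Z t \<omega> = u \<bullet> (Z 0 \<omega> + integral {0..t} (\<lambda>s. A *v Z s \<omega>) + B *v W t \<omega>)" by simp
    ultimately show ?case by (simp add: dot_lmul_matrix inner_add_right)
  qed
qed

lemma brownian_motion_L2_bounded:
  assumes "brownian_motion M W" "0 \<le> t"
  shows "L2_bounded M (t * (b \<bullet> b)) (\<lambda>\<omega>. b \<bullet> W t \<omega>)"
proof (cases "t = 0")
  case True
  have [measurable]: "W 0 \<in> borel_measurable M" using assms by (simp add: brownian_motion_def)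
  have "AE \<omega> in M. W 0 \<omega> = 0" using assms by (simp add: brownian_motion_def)
  then have "AE \<omega> in M. 0 = b \<bullet> W 0 \<omega>" by eventually_elim simp
  moreover have "L2_bounded M 0 (\<lambda>_. 0)" by (simp add: L2_bounded_def)
  moreover have "(\<lambda>\<omega>. b \<bullet> W 0 \<omega>) \<in> borel_measurable M" by measurable
  ultimately have "L2_bounded M 0 (\<lambda>\<omega>. b \<bullet> W 0 \<omega>)" by (rule L2_bounded_cong_AE[rotated 2])
  then show ?thesis using True by simp
next
  case False
  then have "has_bochner_integral M (\<lambda>\<omega>. (b \<bullet> W t \<omega>)\<^sup>2) (t * (b \<bullet> b))"
    using assms by (intro brownian_motion_moments) auto
  then show ?thesis
    using brownian_motion_measurable[OF assms]
    by (auto simp: L2_bounded_def has_bochner_integral_iff)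
qed

lemma stationary_L2_iff:
  fixes Z :: "real \<Rightarrow> 'w \<Rightarrow> real^'n"
  assumes "Z t \<in> borel_measurable M" and "distr M borel (Z t) = \<pi>"
  shows "L2_bounded M K (\<lambda>\<omega>. u \<bullet> Z t \<omega>) \<longleftrightarrow> L2_bounded \<pi> K (\<lambda>z. u \<bullet> z)"
proof -
  have Z: "Z t \<in> measurable M borel" by fact
  have m: "(\<lambda>z. u \<bullet> z) \<in> borel_measurable borel" "(\<lambda>z. (u \<bullet> z)\<^sup>2) \<in> borel_measurable borel"
    by measurable
  show ?thesis
    using measurable_compose[OF Z m(1)] m(1)
    unfolding assms(2)[symmetric] L2_bounded_def
      integrable_distr_eq[OF Z m(2)] integral_distr[OF Z m(2)]
    by simp
qed

lemma linear_sde_measurable: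
  "linear_sde_solution A B M W Z \<Longrightarrow> 0 \<le> t \<Longrightarrow> Z t \<in> borel_measurable M"
  by (simp add: linear_sde_solution_def)

lemma linear_sde_brownian_motion: "linear_sde_solution A B M W Z \<Longrightarrow> brownian_motion M W"
  by (simp add: linear_sde_solution_def)

text \<open>
  In a stationary process the drift has the same second moment at all times, so its integral over
  \<open>[0, t]\<close> is of order \<open>t\<close> in \<open>L\<^sup>2\<close>.
\<close>

lemma stationary_drift_L2_bounded:
  fixes A :: "real^'n^'n" and B :: "real^'m^'n"
  assumes sol: "linear_sde_solution A B M W Z" and stat: "\<And>t. 0 \<le> t \<Longrightarrow> distr M borel (Z t) = \<pi>"
    and v: "L2_bounded \<pi> K (\<lambda>z. (u v* A) \<bullet> z)" and t: "0 \<le> t"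
  shows "L2_bounded M (t\<^sup>2 * K) (\<lambda>\<omega>. u \<bullet> Z t \<omega> - u \<bullet> Z 0 \<omega> - (u v* B) \<bullet> W t \<omega>)"
proof (rule L2_bounded_time_integral[OF t])
  have [measurable]: "Z t \<in> borel_measurable M" "Z 0 \<in> borel_measurable M" "W t \<in> borel_measurable M"
    using linear_sde_measurable[OF sol] brownian_motion_measurable[OF linear_sde_brownian_motion[OF sol]] t by auto
  show "(\<lambda>\<omega>. u \<bullet> Z t \<omega> - u \<bullet> Z 0 \<omega> - (u v* B) \<bullet> W t \<omega>) \<in> borel_measurable M" by measurable
  show "L2_bounded M K (\<lambda>\<omega>. (u v* A) \<bullet> Z s \<omega>)" if "0 \<le> s" "s \<le> t" for s
    using stationary_L2_iff[of Z s M \<pi> K "u v* A"] linear_sde_measurable[OF sol] stat v that by blast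
  show "AE \<omega> in M. continuous_on {0..t} (\<lambda>s. (u v* A) \<bullet> Z s \<omega>)"
    by (rule linear_sde_scalar_continuous[OF sol])
  show "AE \<omega> in M. u \<bullet> Z t \<omega> - u \<bullet> Z 0 \<omega> - (u v* B) \<bullet> W t \<omega> = integral {0..t} (\<lambda>s. (u v* A) \<bullet> Z s \<omega>)"
    by (rule linear_sde_scalar_equation[OF sol t])
qed

lemma stationary_increment_L2_bounded:
  fixes A :: "real^'n^'n" and B :: "real^'m^'n"
  assumes sol: "linear_sde_solution A B M W Z" and stat: "\<And>t. 0 \<le> t \<Longrightarrow> distr M borel (Z t) = \<pi>"
    and v: "L2_bounded \<pi> K (\<lambda>z. (u v* A) \<bullet> z)" and t: "0 \<le> t"
  shows "L2_bounded M (2 * (t\<^sup>2 * K) + 2 * (t * ((u v* B) \<bullet> (u v* B)))) (\<lambda>\<omega>. u \<bullet> Z t \<omega> - u \<bullet> Z 0 \<omega>)"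
proof -
  have "L2_bounded M (2 * (t\<^sup>2 * K) + 2 * (t * ((u v* B) \<bullet> (u v* B))))
      (\<lambda>\<omega>. (u \<bullet> Z t \<omega> - u \<bullet> Z 0 \<omega> - (u v* B) \<bullet> W t \<omega>) + (u v* B) \<bullet> W t \<omega>)"
    by (rule L2_bounded_add[OF stationary_drift_L2_bounded[OF sol stat v t]
          brownian_motion_L2_bounded[OF linear_sde_brownian_motion[OF sol] t]])
  then show ?thesis by (simp only: diff_add_cancel)
qed

text \<open>
  The drift accumulated over \<open>[0, t]\<close> is \<open>t\<close> times the initial drift, up to
  the integral of an increment, which is of higher order in \<open>t\<close>.
\<close>

lemma linear_sde_second_order_drift:
  fixes A :: "real^'n^'n" and B :: "real^'m^'n"
  assumes sol: "linear_sde_solution A B M W Z" and t: "0 \<le> t"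
  shows "AE \<omega> in M. u \<bullet> Z t \<omega> - u \<bullet> Z 0 \<omega> - (u v* B) \<bullet> W t \<omega> - t * ((u v* A) \<bullet> Z 0 \<omega>)
    = integral {0..t} (\<lambda>s. (u v* A) \<bullet> Z s \<omega> - (u v* A) \<bullet> Z 0 \<omega>)"
  using linear_sde_scalar_equation[OF sol t, of u] linear_sde_scalar_continuous[OF sol, of t "u v* A"]
proof eventually_elim
  case (elim \<omega>)
  have "integral {0..t} (\<lambda>s. (u v* A) \<bullet> Z s \<omega> - (u v* A) \<bullet> Z 0 \<omega>)
      = integral {0..t} (\<lambda>s. (u v* A) \<bullet> Z s \<omega>) - integral {0..t} (\<lambda>s. (u v* A) \<bullet> Z 0 \<omega>)"
    by (intro Henstock_Kurzweil_Integration.integral_diff integrable_continuous_interval elim(2) continuous_on_const)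
  also have "integral {0..t} (\<lambda>s. (u v* A) \<bullet> Z 0 \<omega>) = t * ((u v* A) \<bullet> Z 0 \<omega>)"
    using t by simp
  finally show ?case by (simp only: elim(1))
qed

text \<open>
  If \<open>u \<bullet> Z\<close> is square-integrable, then so is its accumulated drift, the time integral of
  \<open>(u v* A) \<bullet> Z\<close>, since the equation expresses it by \<open>u \<bullet> Z\<close> and the noise. The
  integrand itself varies in \<open>L\<^sup>2\<close> by a bounded amount on \<open>[0, 1]\<close>: by \<open>AA\<close>
  its own drift is a combination of \<open>u \<bullet> Z\<close> and \<open>(u v* A) \<bullet> Z\<close>, whose time
  integrals are under control. So the integrand differs from its average over \<open>[0, 1]\<close> by a
  square-integrable amount, and must be square-integrable. In dimension two \<open>AA\<close> is an instance
  of the Cayley--Hamilton theorem.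
\<close>

lemma stationary_second_moment_propagates:
  fixes A :: "real^'n^'n" and B :: "real^'m^'n"
  assumes sol: "linear_sde_solution A B M W Z" and stat: "\<And>t. 0 \<le> t \<Longrightarrow> distr M borel (Z t) = \<pi>"
    and u: "L2_bounded \<pi> K (\<lambda>z. u \<bullet> z)"
    and AA: "(u v* A) v* A = \<alpha> *\<^sub>R u + \<beta> *\<^sub>R (u v* A)"
  shows "\<exists>L. L2_bounded \<pi> L (\<lambda>z. (u v* A) \<bullet> z)"
proof -
  define v where "v = u v* A"
  define b where "b = u v* B"
  define c where "c = v v* B"
  define F where "F = (\<lambda>s \<omega>. u \<bullet> Z s \<omega> - u \<bullet> Z 0 \<omega> - b \<bullet> W s \<omega>)"
  note bm = linear_sde_brownian_motion[OF sol]
  have [measurable]: "Z s \<in> borel_measurable M" "W s \<in> borel_measurable M" if "0 \<le> s" for s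
    using linear_sde_measurable[OF sol] brownian_motion_measurable[OF bm] that by auto
  have uZ: "L2_bounded M K (\<lambda>\<omega>. u \<bullet> Z s \<omega>)" if "0 \<le> s" for s
    using stationary_L2_iff[of Z s M \<pi> K u] stat[OF that] u that by simp
  have noise: "L2_bounded M (x \<bullet> x) (\<lambda>\<omega>. x \<bullet> W s \<omega>)" if "0 \<le> s" "s \<le> 1" for s x
    using brownian_motion_L2_bounded[OF bm that(1), of x]
    by (rule L2_bounded_mono) (use that in \<open>simp add: mult_left_le_one_le\<close>)
  have F: "L2_bounded M (2 * (2 * K + 2 * K) + 2 * (b \<bullet> b)) (F s)" if "0 \<le> s" "s \<le> 1" for s
    unfolding F_def using uZ noise that by (intro L2_bounded_diff) auto
  \<comment> \<open>\<open>H s\<close> is \<open>\<alpha>\<close> times the time integral of \<open>u \<bullet> Z\<close>, written so that its measurability is evident\<close>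
  define H where "H = (\<lambda>s \<omega>. v \<bullet> Z s \<omega> - v \<bullet> Z 0 \<omega> - c \<bullet> W s \<omega> - \<beta> * F s \<omega>)"
  have H: "L2_bounded M (\<alpha>\<^sup>2 * K) (H s)" if s: "0 \<le> s" "s \<le> 1" for s
  proof (rule L2_bounded_mono)
    show "L2_bounded M (s\<^sup>2 * (\<alpha>\<^sup>2 * K)) (H s)"
    proof (rule L2_bounded_time_integral[OF s(1)])
      show "L2_bounded M (\<alpha>\<^sup>2 * K) (\<lambda>\<omega>. \<alpha> * (u \<bullet> Z r \<omega>))" if "0 \<le> r" "r \<le> s" for r
        using uZ that by (intro L2_bounded_cmult)
      show "AE \<omega> in M. continuous_on {0..s} (\<lambda>r. \<alpha> * (u \<bullet> Z r \<omega>))"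
        using linear_sde_scalar_continuous[OF sol, of s u] by eventually_elim (rule continuous_on_mult_left)
      show "H s \<in> borel_measurable M" using s unfolding H_def F_def by measurable
      show "AE \<omega> in M. H s \<omega> = integral {0..s} (\<lambda>r. \<alpha> * (u \<bullet> Z r \<omega>))"
        using linear_sde_scalar_equation[OF sol s(1), of u] linear_sde_scalar_equation[OF sol s(1), of v]
          linear_sde_scalar_continuous[OF sol, of s u] linear_sde_scalar_continuous[OF sol, of s v]
      proof eventually_elim
        case (elim \<omega>)
        have iu: "(\<lambda>r. u \<bullet> Z r \<omega>) integrable_on {0..s}" and iv: "(\<lambda>r. v \<bullet> Z r \<omega>) integrable_on {0..s}"
          using elim by (auto intro!: integrable_continuous_interval)
        have "v \<bullet> Z s \<omega> - v \<bullet> Z 0 \<omega> - c \<bullet> W s \<omega> = integral {0..s} (\<lambda>r. \<alpha> * (u \<bullet> Z r \<omega>) + \<beta> * (v \<bullet> Z r \<omega>))"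
          using elim(2) AA by (simp add: v_def c_def inner_add_left)
        also have "\<dots> = integral {0..s} (\<lambda>r. \<alpha> * (u \<bullet> Z r \<omega>)) + \<beta> * integral {0..s} (\<lambda>r. v \<bullet> Z r \<omega>)"
          using iu iv by (subst Henstock_Kurzweil_Integration.integral_add) (auto intro: integrable_on_mult_right)
        also have "integral {0..s} (\<lambda>r. v \<bullet> Z r \<omega>) = F s \<omega>"
          using elim(1) by (simp add: F_def v_def b_def)
        finally show ?case by (simp add: H_def)
      qed
    qed
    have "s\<^sup>2 \<le> 1" using s by (simp add: power_le_one)
    then show "s\<^sup>2 * (\<alpha>\<^sup>2 * K) \<le> \<alpha>\<^sup>2 * K"
      using L2_bounded_nonneg[OF u] by (simp add: mult_left_le_one_le)
  qed
  obtain C where v_inc: "\<And>s. 0 \<le> s \<Longrightarrow> s \<le> 1 \<Longrightarrow> L2_bounded M C (\<lambda>\<omega>. v \<bullet> Z s \<omega> - v \<bullet> Z 0 \<omega>)"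
  proof
    fix s :: real assume "0 \<le> s" "s \<le> 1"
    from L2_bounded_add[OF L2_bounded_add[OF H noise] L2_bounded_cmult[OF F], OF this this this, of c \<beta>]
    show "L2_bounded M (2 * (2 * (\<alpha>\<^sup>2 * K) + 2 * (c \<bullet> c)) + 2 * (\<beta>\<^sup>2 * (2 * (2 * K + 2 * K) + 2 * (b \<bullet> b))))
        (\<lambda>\<omega>. v \<bullet> Z s \<omega> - v \<bullet> Z 0 \<omega>)"
      by (simp add: H_def)
  qed
  have "L2_bounded M (1\<^sup>2 * C) (\<lambda>\<omega>. F 1 \<omega> - v \<bullet> Z 0 \<omega>)"
  proof (rule L2_bounded_time_integral)
    show "AE \<omega> in M. continuous_on {0..1} (\<lambda>s. v \<bullet> Z s \<omega> - v \<bullet> Z 0 \<omega>)"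
      using linear_sde_scalar_continuous[OF sol, of 1 v] by eventually_elim (intro continuous_on_diff continuous_on_const)
    show "AE \<omega> in M. F 1 \<omega> - v \<bullet> Z 0 \<omega> = integral {0..1} (\<lambda>s. v \<bullet> Z s \<omega> - v \<bullet> Z 0 \<omega>)"
      using linear_sde_second_order_drift[OF sol, of 1 u] by (simp add: F_def v_def b_def)
    show "(\<lambda>\<omega>. F 1 \<omega> - v \<bullet> Z 0 \<omega>) \<in> borel_measurable M" unfolding F_def by measurable
  qed (use v_inc in auto)
  from L2_bounded_diff[OF F[of 1] this]
  have "\<exists>L. L2_bounded M L (\<lambda>\<omega>. v \<bullet> Z 0 \<omega>)" by auto
  then show ?thesis
    using stationary_L2_iff[of Z 0 M \<pi>] stat[of 0] by (simp add: v_def)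
qed

text \<open>
  This is Ito's formula for \<open>(u \<bullet> Z)\<^sup>2\<close> in expectation, obtained from an expansion
  to first order in the length \<open>t\<close> of a short time interval. With initial value \<open>U\<close>, drift \<open>F\<close> and
  noise \<open>N\<close>, the expectation of \<open>(U + F + N)\<^sup>2\<close> equals that of \<open>U\<^sup>2\<close> by stationarity.
  The noise contributes \<open>t\<close> times \<open>(u v* B) \<bullet> (u v* B)\<close>; the drift is \<open>t\<close> times its
  initial value up to a remainder \<open>G\<close> of order \<open>t powr (3/2)\<close> in \<open>L\<^sup>2\<close>; initial
  values are uncorrelated with the noise. What is left is of order \<open>t powr (3/2)\<close>, so the
  coefficient of \<open>t\<close> vanishes.
\<close>

lemma stationary_lyapunov_equation:
  fixes A :: "real^'n^'n" and B :: "real^'m^'n"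
  assumes sol: "linear_sde_solution A B M W Z" and stat: "\<And>t. 0 \<le> t \<Longrightarrow> distr M borel (Z t) = \<pi>"
    and L2: "\<And>x. \<exists>K. L2_bounded \<pi> K (\<lambda>z. x \<bullet> z)"
  shows "2 * (\<integral>z. (u \<bullet> z) * ((u v* A) \<bullet> z) \<partial>\<pi>) + (u v* B) \<bullet> (u v* B) = 0"
proof -
  have bm: "brownian_motion M W" by (rule linear_sde_brownian_motion[OF sol])
  then interpret prob_space M by (rule brownian_motion_prob_space)
  define v where "v = u v* A"
  define w where "w = v v* A"
  define b where "b = u v* B"
  define c where "c = v v* B"
  define q where "q = (\<integral>z. (u \<bullet> z) * (v \<bullet> z) \<partial>\<pi>)"
  have [measurable]: "Z s \<in> borel_measurable M" "W s \<in> borel_measurable M" if "0 \<le> s" for s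
    using linear_sde_measurable[OF sol] brownian_motion_measurable[OF bm] that by auto
  obtain Ku Kv Kw where Ku: "L2_bounded \<pi> Ku (\<lambda>z. u \<bullet> z)" and Kv: "L2_bounded \<pi> Kv (\<lambda>z. v \<bullet> z)"
    and Kw: "L2_bounded \<pi> Kw (\<lambda>z. w \<bullet> z)"
    using L2[of u] L2[of v] L2[of w] by blast
  note nonneg = L2_bounded_nonneg[OF Ku] L2_bounded_nonneg[OF Kv] L2_bounded_nonneg[OF Kw]
  have law: "L2_bounded M K (\<lambda>\<omega>. x \<bullet> Z s \<omega>)" if "L2_bounded \<pi> K (\<lambda>z. x \<bullet> z)" "0 \<le> s" for K x s
    using stationary_L2_iff[of Z s M \<pi> K x] stat[OF that(2)] that by simp
  have mean: "integrable M (\<lambda>\<omega>. x \<bullet> Z 0 \<omega>)" for x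
  proof -
    obtain K where "L2_bounded \<pi> K (\<lambda>z. x \<bullet> z)" using L2 by blast
    then have "L2_bounded M K (\<lambda>\<omega>. x \<bullet> Z 0 \<omega>)" by (rule law) simp
    from square_integrable_imp_integrable[OF L2_bounded_measurable[OF this] L2_bounded_square_integrable[OF this]]
    show ?thesis .
  qed
  define C where "C = 2 * Kw + 2 * (c \<bullet> c)"
  have C: "0 \<le> C" using nonneg by (simp add: C_def)
  define R where "R = Ku + C + (Kv + C + b \<bullet> b)"
  have bound: "\<bar>2 * q + b \<bullet> b\<bar> \<le> h * R" if h: "0 < h" "h \<le> 1" for h
  proof -
    \<comment> \<open>in terms of the square root \<open>h\<close> of the time step all orders are integers\<close>
    define t where "t = h\<^sup>2"
    have t: "0 < t" "t \<le> 1" using h by (auto simp: t_def power_le_one)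
    have t0: "0 \<le> t" using t by simp
    define U where "U = (\<lambda>\<omega>. u \<bullet> Z 0 \<omega>)"
    define V where "V = (\<lambda>\<omega>. v \<bullet> Z 0 \<omega>)"
    define N where "N = (\<lambda>\<omega>. b \<bullet> W t \<omega>)"
    define F where "F = (\<lambda>\<omega>. u \<bullet> Z t \<omega> - U \<omega> - N \<omega>)"
    define G where "G = (\<lambda>\<omega>. F \<omega> - t * V \<omega>)"
    have U: "L2_bounded M Ku U" and V: "L2_bounded M Kv V"
      using law[OF Ku] law[OF Kv] by (auto simp: U_def V_def)
    have N: "L2_bounded M (t * (b \<bullet> b)) N"
      unfolding N_def using bm t0 by (rule brownian_motion_L2_bounded)
    have F: "L2_bounded M (t\<^sup>2 * Kv) F"
      using stationary_drift_L2_bounded[OF sol stat Kv[unfolded v_def] t0]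
      by (simp add: F_def[abs_def] U_def N_def b_def)
    have G: "L2_bounded M (t\<^sup>2 * (t * C)) G"
    proof (rule L2_bounded_time_integral[OF t0])
      fix s assume s: "0 \<le> s" "s \<le> t"
      have "s\<^sup>2 \<le> t"
        using s t by (metis mult_mono mult.right_neutral order_trans power2_eq_square)
      then have "2 * (s\<^sup>2 * Kw) + 2 * (s * (c \<bullet> c)) \<le> 2 * (t * Kw) + 2 * (t * (c \<bullet> c))"
        using s nonneg by (intro add_mono mult_left_mono mult_right_mono) auto
      also have "\<dots> = t * C" by (simp add: C_def algebra_simps)
      finally show "L2_bounded M (t * C) (\<lambda>\<omega>. v \<bullet> Z s \<omega> - v \<bullet> Z 0 \<omega>)"
        using stationary_increment_L2_bounded[OF sol stat Kw[unfolded w_def] s(1)]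
        unfolding c_def by (rule L2_bounded_mono[rotated])
    next
      show "AE \<omega> in M. continuous_on {0..t} (\<lambda>s. v \<bullet> Z s \<omega> - v \<bullet> Z 0 \<omega>)"
        using linear_sde_scalar_continuous[OF sol, of t v] by eventually_elim (intro continuous_on_diff continuous_on_const)
      show "AE \<omega> in M. G \<omega> = integral {0..t} (\<lambda>s. v \<bullet> Z s \<omega> - v \<bullet> Z 0 \<omega>)"
        using linear_sde_second_order_drift[OF sol t0, of u]
        by (simp add: G_def F_def U_def V_def N_def v_def b_def)
      show "G \<in> borel_measurable M"
        unfolding G_def F_def U_def V_def N_def using t0 by measurable
    qed
    have UV: "(\<integral>\<omega>. U \<omega> * V \<omega> \<partial>M) = q"
      unfolding q_def U_def V_def stat[of 0, OF order_refl, symmetric] by (subst integral_distr) auto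
    have UN: "(\<integral>\<omega>. U \<omega> * N \<omega> \<partial>M) = 0" and VN: "(\<integral>\<omega>. V \<omega> * N \<omega> \<partial>M) = 0"
      unfolding U_def V_def N_def using mean t by (auto intro!: linear_sde_initial_noise_uncorrelated[OF sol])
    have NN: "(\<integral>\<omega>. (N \<omega>)\<^sup>2 \<partial>M) = t * (b \<bullet> b)"
      unfolding N_def using brownian_motion_moments(2)[OF bm t(1)] by (simp add: has_bochner_integral_iff)
    have UU: "(\<integral>\<omega>. (u \<bullet> Z t \<omega>)\<^sup>2 \<partial>M) = (\<integral>\<omega>. (U \<omega>)\<^sup>2 \<partial>M)"
    proof -
      have "(\<integral>\<omega>. (u \<bullet> Z s \<omega>)\<^sup>2 \<partial>M) = (\<integral>z. (u \<bullet> z)\<^sup>2 \<partial>\<pi>)" if "0 \<le> s" for s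
        unfolding stat[OF that, symmetric] using that by (subst integral_distr) auto
      then show ?thesis using t0 by (simp add: U_def)
    qed
    \<comment> \<open>any weight gives integrability of the products\<close>
    note int = L2_bounded_square_integrable[OF U] L2_bounded_square_integrable[OF F]
      L2_bounded_square_integrable[OF N] L2_bounded_product(1)[OF U V zero_less_one]
      L2_bounded_product(1)[OF U G zero_less_one] L2_bounded_product(1)[OF U N zero_less_one]
      L2_bounded_product(1)[OF V N zero_less_one] L2_bounded_product(1)[OF G N zero_less_one]
    have expand: "(u \<bullet> Z t \<omega>)\<^sup>2 = (U \<omega>)\<^sup>2 + (F \<omega>)\<^sup>2 + (N \<omega>)\<^sup>2 + 2 * t * (U \<omega> * V \<omega>) + 2 * (U \<omega> * G \<omega>)
        + 2 * (U \<omega> * N \<omega>) + 2 * t * (V \<omega> * N \<omega>) + 2 * (G \<omega> * N \<omega>)" for \<omega>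
    proof -
      have F_G: "F \<omega> = G \<omega> + t * V \<omega>" by (simp add: G_def)
      moreover have "u \<bullet> Z t \<omega> = U \<omega> + F \<omega> + N \<omega>" by (simp add: F_def)
      ultimately have "u \<bullet> Z t \<omega> = U \<omega> + (G \<omega> + t * V \<omega>) + N \<omega>" by (simp only:)
      then show ?thesis unfolding F_G by (simp only:) (simp add: power2_eq_square algebra_simps)
    qed
    have "(\<integral>\<omega>. (u \<bullet> Z t \<omega>)\<^sup>2 \<partial>M) = (\<integral>\<omega>. (U \<omega>)\<^sup>2 \<partial>M) + (\<integral>\<omega>. (F \<omega>)\<^sup>2 \<partial>M) + t * (b \<bullet> b)
        + 2 * t * q + 2 * (\<integral>\<omega>. U \<omega> * G \<omega> \<partial>M) + 2 * (\<integral>\<omega>. G \<omega> * N \<omega> \<partial>M)"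
      unfolding expand using int by (simp add: UV UN VN NN)
    then have "t * (2 * q + b \<bullet> b)
        = - (\<integral>\<omega>. (F \<omega>)\<^sup>2 \<partial>M) - 2 * (\<integral>\<omega>. U \<omega> * G \<omega> \<partial>M) - 2 * (\<integral>\<omega>. G \<omega> * N \<omega> \<partial>M)"
      unfolding UU by (simp add: algebra_simps)
    moreover have "\<bar>\<integral>\<omega>. (F \<omega>)\<^sup>2 \<partial>M\<bar> \<le> h ^ 4 * Kv"
      using L2_bounded_le[OF F] by (simp add: t_def flip: power_mult)
    moreover have "2 * \<bar>\<integral>\<omega>. U \<omega> * G \<omega> \<partial>M\<bar> \<le> h ^ 3 * (Ku + C)"
    proof -
      \<comment> \<open>\<open>U\<close> has order \<open>1\<close> and \<open>G\<close> order \<open>h ^ 3\<close>: weight \<open>h ^ 3\<close> balances them\<close>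
      have "t\<^sup>2 * (t * C) / h ^ 3 = h ^ 3 * C"
        using h by (simp add: t_def eval_nat_numeral field_simps)
      then show ?thesis
        using L2_bounded_product(2)[OF U G, of "h ^ 3"] h by (simp add: algebra_simps)
    qed
    moreover have "2 * \<bar>\<integral>\<omega>. G \<omega> * N \<omega> \<partial>M\<bar> \<le> h ^ 4 * (C + b \<bullet> b)"
    proof -
      \<comment> \<open>\<open>G\<close> has order \<open>h ^ 3\<close> and \<open>N\<close> order \<open>h\<close>: weight \<open>1 / h\<^sup>2\<close> balances them\<close>
      have "1 / t * (t\<^sup>2 * (t * C)) + t * (b \<bullet> b) / (1 / t) = t\<^sup>2 * (C + b \<bullet> b)"
        using t by (simp add: power2_eq_square algebra_simps)
      moreover have "t\<^sup>2 = h ^ 4" by (simp add: t_def flip: power_mult)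
      moreover have "0 < 1 / t" using t by simp
      ultimately show ?thesis
        using L2_bounded_product(2)[OF G N, of "1 / t"] by simp
    qed
    moreover have "h ^ 4 * Kv + h ^ 4 * (C + b \<bullet> b) = h ^ 4 * (Kv + C + b \<bullet> b)"
      by (simp add: algebra_simps)
    ultimately have "\<bar>t * (2 * q + b \<bullet> b)\<bar> \<le> h ^ 3 * (Ku + C) + h ^ 4 * (Kv + C + b \<bullet> b)"
      by linarith
    also have "\<dots> \<le> h ^ 3 * (Ku + C) + h ^ 3 * (Kv + C + b \<bullet> b)"
      using h nonneg C by (intro add_left_mono mult_right_mono power_decreasing) auto
    also have "\<dots> = t * (h * R)" by (simp add: R_def t_def eval_nat_numeral algebra_simps)
    finally show ?thesis using t by (simp add: abs_mult)
  qed
  have "((\<lambda>h. h * R) \<longlongrightarrow> 0 * R) (at_right 0)" by (intro tendsto_intros)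
  moreover have "eventually (\<lambda>h. \<bar>2 * q + b \<bullet> b\<bar> \<le> h * R) (at_right 0)"
    by (rule eventually_mono[OF eventually_at_right_real[OF zero_less_one]]) (auto intro: bound)
  ultimately have "\<bar>2 * q + b \<bullet> b\<bar> \<le> 0 * R"
    by (intro tendsto_lowerbound) auto
  then show ?thesis by (simp add: q_def v_def b_def)
qed

section \<open>The prescribed marginal\<close>

lemma mu_star_normal:
  assumes "0 < c\<^sub>f" "0 < c\<^sub>g"
  shows "mu_star k c\<^sub>f c\<^sub>g = density lborel (normal_density 0 (sqrt (c\<^sub>f * c\<^sub>g / (k\<^sup>2 * c\<^sub>g + c\<^sub>f))))"
proof -
  define D where "D = k\<^sup>2 * c\<^sub>g + c\<^sub>f"
  define \<sigma> where "\<sigma> = sqrt (c\<^sub>f * c\<^sub>g / D)"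
  have D: "0 < D" using assms by (simp add: D_def add_nonneg_pos)
  have \<sigma>: "0 < \<sigma>" "\<sigma>\<^sup>2 = c\<^sub>f * c\<^sub>g / D" using assms D by (auto simp: \<sigma>_def)
  define n where "n = sqrt (2 * pi * \<sigma>\<^sup>2)"
  have n: "0 < n" using \<sigma>(1) by (simp add: n_def)
  have weight: "mu_weight k c\<^sub>f c\<^sub>g y = n * normal_density 0 \<sigma> y" for y
  proof -
    have "- (D / (2 * c\<^sub>f * c\<^sub>g) * y\<^sup>2) = - (y - 0)\<^sup>2 / (2 * \<sigma>\<^sup>2)"
      using assms D by (simp add: \<sigma>(2) field_simps)
    then show ?thesis
      using n by (simp add: mu_weight_def normal_density_def flip: n_def D_def)
  qed
  have "(LINT y|lborel. mu_weight k c\<^sub>f c\<^sub>g y) = n"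
    using \<sigma>(1) by (simp add: weight)
  then show ?thesis
    using n unfolding mu_star_def weight by (simp add: \<sigma>_def D_def)
qed

lemma mu_star_second_moment:
  assumes "0 < c\<^sub>f" "0 < c\<^sub>g"
  shows "has_bochner_integral (mu_star k c\<^sub>f c\<^sub>g) (\<lambda>x. x\<^sup>2) (c\<^sub>f * c\<^sub>g / (k\<^sup>2 * c\<^sub>g + c\<^sub>f))"
proof -
  define v where "v = c\<^sub>f * c\<^sub>g / (k\<^sup>2 * c\<^sub>g + c\<^sub>f)"
  have v: "0 < v" using assms by (simp add: v_def add_nonneg_pos)
  have "has_bochner_integral lborel (\<lambda>x. normal_density 0 (sqrt v) x *\<^sub>R x\<^sup>2) v"
    using normal_moment_even[of "sqrt v" 0 1] v by (simp add: fact_numeral)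
  then have "has_bochner_integral (density lborel (normal_density 0 (sqrt v))) (\<lambda>x. x\<^sup>2) v"
    by (intro has_bochner_integral_density) auto
  then show ?thesis unfolding v_def by (simp only: mu_star_normal[OF assms])
qed

section \<open>Inconsistency of the moment equations\<close>

text \<open>
  The three relations are the Lyapunov equation for \<open>c\<^sub>f = c\<^sub>g = 1\<close>, tested against
  \<open>(1, 0)\<close>, \<open>(0, 1)\<close> and \<open>(1, 1)\<close>. Eliminating \<open>q\<close> and \<open>r\<close> leaves one linear
  relation between the entries of \<open>B B\<^sup>T\<close> for each \<open>k\<close>. Comparing \<open>k\<close> with \<open>-k\<close> removes
  the off-diagonal entry, and comparing \<open>k = 1\<close> with \<open>k = 2\<close> forces \<open>D11 / 2 + D22 / (2 * lam) = 0\<close>,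
  hence \<open>D11 = D22 = 0\<close>. The relation at \<open>k = 1\<close> then reads \<open>0 = 1 + lam\<close>.
\<close>

lemma stationary_moment_relations_inconsistent:
  fixes lam D11 D22 S :: real
  assumes lam: "0 < lam" and D: "0 \<le> D11" "0 \<le> D22"
    and rel: "\<And>k. k \<noteq> 0 \<Longrightarrow> \<exists>q r.
      D11 = 2 * (1 / (k\<^sup>2 + 1) + k * q) \<and>
      D22 = 2 * (lam * r - lam * k * q) \<and>
      S = 2 * ((1 - lam * k) * (1 / (k\<^sup>2 + 1)) + ((1 - lam * k) + (k + lam)) * q + (k + lam) * r)"
  shows False
proof -
  \<comment> \<open>polarization: the off-diagonal entry of \<open>B B\<^sup>T\<close>\<close>
  define D12 where "D12 = (S - D11 - D22) / 2"
  have key: "(1 + lam + k\<^sup>2) * (D11 / 2) + k\<^sup>2 * (D22 / (2 * lam)) = 1 + lam + k * D12"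
    if k: "k \<noteq> 0" for k
  proof -
    define p where "p = 1 / (k\<^sup>2 + 1)"
    obtain q r where 1: "D11 = 2 * (p + k * q)" and 2: "D22 = 2 * (lam * r - lam * k * q)"
      and 3: "S = 2 * ((1 - lam * k) * p + ((1 - lam * k) + (k + lam)) * q + (k + lam) * r)"
      using rel[OF k] unfolding p_def by blast
    have p: "p * (k\<^sup>2 + 1) = 1" by (simp add: p_def add_nonneg_pos[THEN less_imp_neq, symmetric])
    have D22: "D22 / (2 * lam) = r - k * q" using lam by (simp add: 2 field_simps)
    have D11: "D11 / 2 = p + k * q" by (simp add: 1)
    have "D12 = - lam * k * p + (1 + lam) * q + k * r"
      by (simp add: D12_def 1 2 3 field_simps)
    then have D12: "k * D12 = k * (- lam * k * p + (1 + lam) * q + k * r)" by simp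
    have "(1 + lam + k\<^sup>2) * (D11 / 2) + k\<^sup>2 * (D22 / (2 * lam)) - k * D12
        = (1 + lam) * (p * (k\<^sup>2 + 1))"
      unfolding D22 D11 D12 by (simp add: power2_eq_square algebra_simps)
    then show ?thesis by (simp add: p)
  qed
  define a where "a = D11 / 2"
  define d where "d = D22 / (2 * lam)"
  have "(2 + lam) * a + d = 1 + lam + D12" "(2 + lam) * a + d = 1 + lam - D12"
    "(5 + lam) * a + 4 * d = 1 + lam + 2 * D12"
    using key[of 1] key[of "-1"] key[of 2] by (simp_all add: a_def d_def add.commute)
  then have "a + d = 0" "(1 + lam) * a = 1 + lam" by (auto simp: algebra_simps)
  moreover have "0 \<le> a" "0 \<le> d" using D lam by (simp_all add: a_def d_def)
  ultimately show False using lam by (simp add: add_nonneg_eq_0_iff)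
qed

lemma vector_mult_neg_coupling_matrix:
  "u v* (- coupling_matrix lam k c\<^sub>f c\<^sub>g)
    = - vector [inverse c\<^sub>g * u $ 1 - lam * k * u $ 2, k * u $ 1 + lam * c\<^sub>f * u $ 2]"
  by (simp add: vec_eq_iff forall_2 vector_matrix_mult_def sum_2 coupling_matrix_def algebra_simps)

lemma inner_real2: "(u :: real^2) \<bullet> z = u $ 1 * z $ 1 + u $ 2 * z $ 2"
  by (simp add: inner_vec_def sum_2)

text \<open>
  The Lyapunov equation in coordinates; \<open>q\<close> and \<open>r\<close> are the mixed moment and the second
  moment of \<open>y\<close>. Since \<open>k \<noteq> 0\<close>, the drift of \<open>x\<close> involves \<open>y\<close>, so the finite second moment
  of the prescribed \<open>x\<close>-marginal propagates to \<open>y\<close>.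
\<close>

lemma stationary_second_moment_relations:
  fixes B :: "real^2^2"
  assumes stat: "stationary_distribution (- coupling_matrix lam k c\<^sub>f c\<^sub>g) B \<pi>"
    and marg: "x_marginal \<pi> = mu_star k c\<^sub>f c\<^sub>g"
    and k: "k \<noteq> 0" and c: "0 < c\<^sub>f" "0 < c\<^sub>g"
  shows "\<exists>q r. \<forall>u. (u v* B) \<bullet> (u v* B) =
    2 * (u $ 1 * (inverse c\<^sub>g * u $ 1 - lam * k * u $ 2) * (c\<^sub>f * c\<^sub>g / (k\<^sup>2 * c\<^sub>g + c\<^sub>f))
      + (u $ 1 * (k * u $ 1 + lam * c\<^sub>f * u $ 2) + u $ 2 * (inverse c\<^sub>g * u $ 1 - lam * k * u $ 2)) * q
      + u $ 2 * (k * u $ 1 + lam * c\<^sub>f * u $ 2) * r)"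
proof -
  define A where "A = - coupling_matrix lam k c\<^sub>f c\<^sub>g"
  define p where "p = c\<^sub>f * c\<^sub>g / (k\<^sup>2 * c\<^sub>g + c\<^sub>f)"
  obtain M :: "(real \<Rightarrow> (real^2) \<times> (real^2)) measure" and W Z
    where sol: "linear_sde_solution A B M W Z" and law: "\<And>t. 0 \<le> t \<Longrightarrow> distr M borel (Z t) = \<pi>"
    using stat unfolding stationary_distribution_def A_def by blast
  have sets_\<pi>[measurable_cong, simp]: "sets \<pi> = sets borel"
    using law[of 0] by (metis order_refl sets_distr)
  have coord[measurable]: "(\<lambda>z::real^2. z $ 1) \<in> borel_measurable \<pi>" "(\<lambda>z::real^2. z $ 2) \<in> borel_measurable \<pi>"
    by (simp_all cong: measurable_cong_sets)
  have "has_bochner_integral (distr \<pi> borel (\<lambda>z. z $ 1)) (\<lambda>x. x\<^sup>2) p"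
    using mu_star_second_moment[OF c] marg by (simp add: x_marginal_def p_def)
  then have xx: "has_bochner_integral \<pi> (\<lambda>z. (z $ 1)\<^sup>2) p"
    by (simp add: has_bochner_integral_iff integrable_distr_eq integral_distr)
  define e :: "real^2" where "e = vector [1, 0]"
  define v where "v = e v* A"
  have v: "v = - vector [inverse c\<^sub>g, k]"
    by (simp add: v_def A_def vector_mult_neg_coupling_matrix e_def)
  have e_inner: "e \<bullet> z = z $ 1" and v_inner: "v \<bullet> z = - (inverse c\<^sub>g * z $ 1 + k * z $ 2)" for z
    by (simp_all add: inner_real2 e_def v)
  have x_L2: "L2_bounded \<pi> p (\<lambda>z. e \<bullet> z)"
    using xx by (simp add: L2_bounded_def e_inner has_bochner_integral_iff)
  \<comment> \<open>Cayley--Hamilton: the coefficients are the negated determinant and the trace of \<open>A\<close>\<close>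
  have "v v* A = - (lam * (inverse c\<^sub>g * c\<^sub>f + k\<^sup>2)) *\<^sub>R e + - (inverse c\<^sub>g + lam * c\<^sub>f) *\<^sub>R v"
    by (simp add: v A_def vector_mult_neg_coupling_matrix e_def vec_eq_iff forall_2 power2_eq_square algebra_simps)
  then obtain L where v_L2: "L2_bounded \<pi> L (\<lambda>z. v \<bullet> z)"
    using stationary_second_moment_propagates[OF sol law x_L2] unfolding v_def by blast
  have L2: "\<exists>K. L2_bounded \<pi> K (\<lambda>z. x \<bullet> z)" for x
  proof -
    have "x \<bullet> z = (x $ 1 - x $ 2 * inverse c\<^sub>g / k) * (e \<bullet> z) + (- x $ 2 / k) * (v \<bullet> z)" for z
      using k by (simp add: inner_real2[of x] e_inner v_inner field_simps)
    then show ?thesis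
      using L2_bounded_add[OF L2_bounded_cmult[OF x_L2] L2_bounded_cmult[OF v_L2],
          of "x $ 1 - x $ 2 * inverse c\<^sub>g / k" "- x $ 2 / k"] by auto
  qed
  have y_L2: "\<exists>K. L2_bounded \<pi> K (\<lambda>z. z $ 2)"
    using L2[of "vector [0, 1]"] by (simp add: inner_real2)
  define q where "q = (\<integral>z. z $ 1 * z $ 2 \<partial>\<pi>)"
  define r where "r = (\<integral>z. (z $ 2)\<^sup>2 \<partial>\<pi>)"
  have xy: "has_bochner_integral \<pi> (\<lambda>z. z $ 1 * z $ 2) q"
    and yy: "has_bochner_integral \<pi> (\<lambda>z. (z $ 2)\<^sup>2) r"
    using y_L2 L2_bounded_product(1)[OF x_L2 _ zero_less_one] L2_bounded_square_integrable
    by (auto simp: e_inner q_def r_def has_bochner_integral_iff)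
  have "(u v* B) \<bullet> (u v* B) =
    2 * (u $ 1 * (inverse c\<^sub>g * u $ 1 - lam * k * u $ 2) * p
      + (u $ 1 * (k * u $ 1 + lam * c\<^sub>f * u $ 2) + u $ 2 * (inverse c\<^sub>g * u $ 1 - lam * k * u $ 2)) * q
      + u $ 2 * (k * u $ 1 + lam * c\<^sub>f * u $ 2) * r)" for u
  proof -
    define \<alpha> where "\<alpha> = inverse c\<^sub>g * u $ 1 - lam * k * u $ 2"
    define \<beta> where "\<beta> = k * u $ 1 + lam * c\<^sub>f * u $ 2"
    have "u v* A = - vector [\<alpha>, \<beta>]"
      by (simp add: A_def vector_mult_neg_coupling_matrix \<alpha>_def \<beta>_def)
    then have expand: "(u \<bullet> z) * ((u v* A) \<bullet> z)
        = - (u $ 1 * \<alpha> * (z $ 1)\<^sup>2 + (u $ 1 * \<beta> + u $ 2 * \<alpha>) * (z $ 1 * z $ 2) + u $ 2 * \<beta> * (z $ 2)\<^sup>2)" for z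
      by (simp add: inner_real2 power2_eq_square algebra_simps)
    have "has_bochner_integral \<pi> (\<lambda>z. (u \<bullet> z) * ((u v* A) \<bullet> z))
        (- (u $ 1 * \<alpha> * p + (u $ 1 * \<beta> + u $ 2 * \<alpha>) * q + u $ 2 * \<beta> * r))"
      unfolding expand
      by (intro has_bochner_integral_minus has_bochner_integral_add has_bochner_integral_mult_right xx xy yy)
    then show ?thesis
      using stationary_lyapunov_equation[OF sol law L2, of u]
      by (simp add: has_bochner_integral_iff \<alpha>_def \<beta>_def)
  qed
  then show ?thesis unfolding p_def by blast
qed

theorem theorem3p6:
  fixes lam :: real
  assumes "lam > 0"
  shows "\<not> (\<exists>B :: real^2^2. \<forall>k c\<^sub>f c\<^sub>g :: real. k \<noteq> 0 \<longrightarrow> c\<^sub>f > 0 \<longrightarrow> c\<^sub>g > 0 \<longrightarrow>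
           (\<exists>\<pi>. stationary_distribution (- coupling_matrix lam k c\<^sub>f c\<^sub>g) B \<pi> \<and>
                x_marginal \<pi> = mu_star k c\<^sub>f c\<^sub>g))"
proof
  assume "\<exists>B :: real^2^2. \<forall>k c\<^sub>f c\<^sub>g :: real. k \<noteq> 0 \<longrightarrow> c\<^sub>f > 0 \<longrightarrow> c\<^sub>g > 0 \<longrightarrow>
           (\<exists>\<pi>. stationary_distribution (- coupling_matrix lam k c\<^sub>f c\<^sub>g) B \<pi> \<and>
                x_marginal \<pi> = mu_star k c\<^sub>f c\<^sub>g)"
  then obtain B :: "real^2^2" where B: "\<And>k. k \<noteq> 0 \<Longrightarrow>
      \<exists>\<pi>. stationary_distribution (- coupling_matrix lam k 1 1) B \<pi> \<and> x_marginal \<pi> = mu_star k 1 1"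
    by (metis zero_less_one)
  define D where "D = (\<lambda>u. (u v* B) \<bullet> (u v* B))"
  have D_nonneg: "0 \<le> D u" for u by (simp add: D_def)
  show False
  proof (rule stationary_moment_relations_inconsistent[OF assms D_nonneg D_nonneg])
    fix k :: real
    assume k: "k \<noteq> 0"
    obtain \<pi> where "stationary_distribution (- coupling_matrix lam k 1 1) B \<pi>"
      and "x_marginal \<pi> = mu_star k 1 1"
      using B[OF k] by blast
    from stationary_second_moment_relations[OF this k]
    obtain q r where rel: "\<And>u. D u =
      2 * (u $ 1 * (u $ 1 - lam * k * u $ 2) * (1 / (k\<^sup>2 + 1))
        + (u $ 1 * (k * u $ 1 + lam * u $ 2) + u $ 2 * (u $ 1 - lam * k * u $ 2)) * q
        + u $ 2 * (k * u $ 1 + lam * u $ 2) * r)"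
      by (auto simp: D_def)
    show "\<exists>q r. D (vector [1, 0]) = 2 * (1 / (k\<^sup>2 + 1) + k * q) \<and>
        D (vector [0, 1]) = 2 * (lam * r - lam * k * q) \<and>
        D (vector [1, 1]) = 2 * ((1 - lam * k) * (1 / (k\<^sup>2 + 1)) + ((1 - lam * k) + (k + lam)) * q + (k + lam) * r)"
      by (intro exI[of _ q] exI[of _ r]) (simp add: rel algebra_simps)
  qed
qed

end
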